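(* Let $C\subset\mathbb{R}$ be a compact set with $\operatorname{conv}(C)=[0,1]$ and thickness $\tau:=\tau(C)>0$. Then the set $S:=(-\infty,0)\cup C\cup(1,+\infty)$ is $\left(\frac{1}{\tau\beta},\beta,0,\frac{\beta}{2}\right)$-winning (in $\mathbb{R}$) for every $\beta\in(0,1)$.
   Context: Thickness. Let $C\subset\mathbb{R}$ be compact with convex hull $I_1=\operatorname{conv}(C)$. The gaps of $C$ are the connected components of $I_1\setminus C$ (disjoint bounded open intervals, finitely or countably many); enumerate them as $(G_n)_n$ by non-increasing length $|G_n|$ (ties broken arbitrarily). For each $n$, the component of $I_1\setminus(G_1\cup\dots\cup G_{n-1})$ containing $G_n$ is a closed interval, and removing $G_n$ from it leaves a closed interval $L_n$ on the left and a closed interval $R_n$ on the right (possibly singletons). The thickness is $\tau(C):=\inf_n \frac{\min\{|L_n|,|R_n|\}}{|G_n|}$ (independent of how ties are broken). If $C$ has no gaps, $\tau(C):=+\infty$ if $C$ has non-empty interior, and $\tau(C):=0$ otherwise. Potential game. Given $\alpha,\beta,\rho>0$ and $c\ge 0$, Alice and Bob play the $(\alpha,\beta,c,\rho)$-potential game in $\mathbb{R}$ as follows. On each turn $m=0,1,2,\dots$ Bob plays first and then Alice. On turn $m$ Bob plays a closed ball $B_m=B[x_m,\rho_m]$, with $\rho_0\ge\rho$ and, for $m\ge 1$, $\rho_m\ge\beta\rho_{m-1}$ and $B_m\subseteq B_{m-1}$. Alice responds by choosing and erasing a finite or countably infinite collection of balls $A_{\rho_{i,m}}$ (open or closed) of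 radii $\rho_{i,m}>0$ with $\sum_i\rho_{i,m}^c\le(\alpha\rho_m)^c$ if $c>0$; if $c=0$ she may erase at most one ball, of radius $\rho_{1,m}\le\alpha\rho_m$. Alice may also pass (erase nothing). Bob must ensure $\lim_{m\to\infty}\rho_m=0$. The outcome is the unique point $x_\infty$ of $\bigcap_m B_m$. A set $S$ is $(\alpha,\beta,c,\rho)$-winning if Alice has a strategy guaranteeing that if $x_\infty\notin\bigcup_m\bigcup_i A_{\rho_{i,m}}$ then $x_\infty\in S$. When $\tau=+\infty$ (so $C=[0,1]$), $\frac1{\tau\beta}$ is read as $0$, and in the corresponding game Alice can only pass. *)

theory Defs
  imports "HOL-Analysis.Analysis"
begin

section \<open>Thickness of a compact subset of the real line\<close>

abbreviation len :: "real set \<Rightarrow> real" where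
  "len J \<equiv> measure lborel J"

definition gaps :: "real set \<Rightarrow> real set set" where
  "gaps C = components (convex hull C - C)"

text \<open>Gaps are numbered from 0; the indices in use are an initial segment of the naturals,
  proper exactly when there are finitely many gaps.\<close>

definition gap_indices :: "real set \<Rightarrow> nat set" where
  "gap_indices C = {n. finite (gaps C) \<longrightarrow> n < card (gaps C)}"

definition gap_enumeration :: "real set \<Rightarrow> (nat \<Rightarrow> real set) \<Rightarrow> bool" where
  "gap_enumeration C G \<longleftrightarrow>
     bij_betw G (gap_indices C) (gaps C) \<and>
     (\<forall>i\<in>gap_indices C. \<forall>j\<in>gap_indices C. i \<le> j \<longrightarrow> len (G j) \<le> len (G i))"

definition parent_interval :: "real set \<Rightarrow> (nat \<Rightarrow> real set) \<Rightarrow> nat \<Rightarrow> real set" where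
  "parent_interval C G n =
     (THE J. J \<in> components (convex hull C - (\<Union>i<n. G i)) \<and> G n \<subseteq> J)"

definition left_bridge :: "real set \<Rightarrow> (nat \<Rightarrow> real set) \<Rightarrow> nat \<Rightarrow> real set" where
  "left_bridge C G n = {x \<in> parent_interval C G n. \<forall>g\<in>G n. x < g}"

definition right_bridge :: "real set \<Rightarrow> (nat \<Rightarrow> real set) \<Rightarrow> nat \<Rightarrow> real set" where
  "right_bridge C G n = {x \<in> parent_interval C G n. \<forall>g\<in>G n. g < x}"

text \<open>The choice operator fixes one of the admissible enumerations; they differ only in how ties
  between gaps of equal length are broken, and the infimum does not depend on that.\<close>

definition thickness :: "real set \<Rightarrow> ereal" where
  "thickness C =
     (if gaps C = {} then (if interior C \<noteq> {} then \<infinity> else 0)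
      else let G = (SOME G. gap_enumeration C G) in
        INF n\<in>gap_indices C.
          ereal (min (len (left_bridge C G n)) (len (right_bridge C G n)) / len (G n)))"


section \<open>The potential game on the real line\<close>

datatype erased_ball =
    Open_Ball (centre: real) (radius: real)
  | Closed_Ball (centre: real) (radius: real)

primrec erased_set :: "erased_ball \<Rightarrow> real set" where
  "erased_set (Open_Ball x r) = ball x r"
| "erased_set (Closed_Ball x r) = cball x r"

text \<open>A play of Bob is given by the centres \<open>x m\<close> and radii \<open>r m\<close> of his closed balls. Positivity
  of all radii follows from \<open>0 < \<rho>\<close> and \<open>0 < \<beta>\<close>.\<close>

definition bob_play :: "real \<Rightarrow> real \<Rightarrow> (nat \<Rightarrow> real) \<Rightarrow> (nat \<Rightarrow> real) \<Rightarrow> bool" where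
  "bob_play \<beta> \<rho> x r \<longleftrightarrow>
     r 0 \<ge> \<rho> \<and>
     (\<forall>m. r (Suc m) \<ge> \<beta> * r m \<and> cball (x (Suc m)) (r (Suc m)) \<subseteq> cball (x m) (r m)) \<and>
     r \<longlonglongrightarrow> 0"

text \<open>The set \<open>A\<close> of balls is a legal answer of Alice to a ball of radius \<open>s\<close>. The empty set
  (passing) is always legal; for \<open>\<alpha> = 0\<close> it is the only legal answer. Summability has to be
  required because \<open>infsum\<close> is 0 for a divergent sum.\<close>

definition alice_legal :: "real \<Rightarrow> real \<Rightarrow> real \<Rightarrow> erased_ball set \<Rightarrow> bool" where
  "alice_legal \<alpha> c s A \<longleftrightarrow>
     countable A \<and> (\<forall>b\<in>A. radius b > 0) \<and>
     (if c = 0 then A = {} \<or> (\<exists>b. A = {b} \<and> radius b \<le> \<alpha> * s)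
      else (\<lambda>b. radius b powr c) summable_on A \<and>
           (\<Sum>\<^sub>\<infinity>b\<in>A. radius b powr c) \<le> (\<alpha> * s) powr c)"

definition bob_history :: "(nat \<Rightarrow> real) \<Rightarrow> (nat \<Rightarrow> real) \<Rightarrow> nat \<Rightarrow> (real \<times> real) list" where
  "bob_history x r m = map (\<lambda>i. (x i, r i)) [0..<Suc m]"

text \<open>A strategy maps the balls played by Bob up to and including the current turn to Alice's
  answer; her own earlier answers are determined by those. The intersection of Bob's balls
  consists of the outcome alone.\<close>

definition potential_winning :: "real \<Rightarrow> real \<Rightarrow> real \<Rightarrow> real \<Rightarrow> real set \<Rightarrow> bool" where
  "potential_winning \<alpha> \<beta> c \<rho> S \<longleftrightarrow>
     (\<exists>\<sigma> :: (real \<times> real) list \<Rightarrow> erased_ball set.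
        \<forall>x r. bob_play \<beta> \<rho> x r \<longrightarrow>
          (\<forall>m. alice_legal \<alpha> c (r m) (\<sigma> (bob_history x r m))) \<and>
          (\<forall>p \<in> (\<Inter>m. cball (x m) (r m)).
             p \<notin> (\<Union>m. \<Union>b\<in>\<sigma> (bob_history x r m). erased_set b) \<longrightarrow> p \<in> S))"

end

theory Submission
  imports Defs
begin

text \<open>Bob's interval has length \<open>2 r\<close>. On each turn Alice erases a gap \<open>g\<close> meeting Bob's
  interval with \<open>\<tau> \<beta> |g| \<le> 2 r \<le> \<tau> |g|\<close>, if there is one. The first inequality makes the move
  legal. By thickness, two points in distinct gaps are more than \<open>\<tau>\<close> times the length of the
  smaller gap apart, so at most one gap satisfying the second inequality can meet Bob's interval.
  Since the length of Bob's interval starts at \<open>\<beta>\<close> or more, where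
  \<open>\<tau> |g| \<le> 1\<close> because bridges lie in \<open>[0,1]\<close>, tends to zero and shrinks at most by
  the factor \<open>\<beta>\<close> per turn, every gap satisfies both inequalities on some turn; hence an outcome
  in a gap is erased.\<close>

section \<open>Enumeration in order of non-increasing size\<close>

text \<open>Always pick a largest remaining element. Finiteness of the superlevel sets makes the
  maximum exist and, when \<open>X\<close> is infinite, guarantees that every element gets its
  turn.\<close>

lemma greedy_enumeration:
  fixes f :: "'a \<Rightarrow> real"
  assumes pos: "\<And>x. x \<in> X \<Longrightarrow> f x > 0"
    and fin: "\<And>e. e > 0 \<Longrightarrow> finite {x \<in> X. f x \<ge> e}"
  defines "I \<equiv> {n. finite X \<longrightarrow> n < card X}"
  shows "\<exists>G. bij_betw G I X \<and> (\<forall>i\<in>I. \<forall>j\<in>I. i \<le> j \<longrightarrow> f (G j) \<le> f (G i))"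
proof -
  define sel where "sel A = (SOME x. x \<in> X - A \<and> (\<forall>y\<in>X - A. f y \<le> f x))" for A
  \<comment> \<open>The recursion runs on the set \<open>H n\<close> of the first \<open>n\<close>
    picks, since the next pick depends on all earlier ones.\<close>
  define H where "H = rec_nat {} (\<lambda>_ A. insert (sel A) A)"
  define G where "G n = sel (H n)" for n
  have H_eq: "H n = G ` {..<n}" for n
    by (induction n) (auto simp: H_def G_def lessThan_Suc)
  have sel: "sel A \<in> X - A \<and> (\<forall>y\<in>X - A. f y \<le> f (sel A))" if "X - A \<noteq> {}" for A
  proof -
    from that obtain x where x: "x \<in> X - A" by auto
    \<comment> \<open>Only elements at least as large as some remaining \<open>x\<close> compete for
      the maximum, and these are finitely many.\<close>
    let ?F = "{y \<in> X - A. f y \<ge> f x}"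
    have "finite ?F" using fin[of "f x"] pos x by (auto elim: rev_finite_subset)
    moreover have "x \<in> ?F" using x by auto
    ultimately have "\<exists>z\<in>?F. f z = Max (f ` ?F)"
      by (metis (mono_tags, lifting) Max_in empty_iff finite_imageI image_iff image_is_empty)
    then obtain z where z: "z \<in> ?F" "f z = Max (f ` ?F)" by blast
    have "f y \<le> f z" if "y \<in> X - A" for y
      using \<open>finite ?F\<close> z that by (cases "f y \<ge> f x") auto
    then have "\<exists>z. z \<in> X - A \<and> (\<forall>y\<in>X - A. f y \<le> f z)" using z by blast
    then show ?thesis unfolding sel_def by (rule someI_ex)
  qed
  have ne: "X - H n \<noteq> {}" if "n \<in> I" for n
  proof
    assume "X - H n = {}"
    then have sub: "X \<subseteq> H n" by blast
    have "finite (H n)" "card (H n) \<le> n"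
      unfolding H_eq using card_image_le[of "{..<n}" G] by auto
    then have "finite X" "card X \<le> n"
      using sub finite_subset[OF sub] card_mono[OF _ sub] by auto
    then show False using that by (simp add: I_def)
  qed
  have GX: "G n \<in> X - H n" and G_max: "\<And>y. y \<in> X - H n \<Longrightarrow> f y \<le> f (G n)" if "n \<in> I" for n
    using sel[OF ne[OF that]] by (auto simp: G_def)
  have inj: "inj_on G I"
  proof (rule linorder_inj_onI)
    show "G i \<noteq> G j" if "i < j" "i \<in> I" "j \<in> I" for i j
    proof -
      have "G i \<in> H j" using \<open>i < j\<close> by (simp add: H_eq)
      then show ?thesis using GX[OF \<open>j \<in> I\<close>] by auto
    qed
  qed auto
  have dec: "f (G j) \<le> f (G i)" if "i \<in> I" "j \<in> I" "i \<le> j" for i j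
  proof (rule G_max[OF \<open>i \<in> I\<close>])
    have "H i \<subseteq> H j" using \<open>i \<le> j\<close> by (auto simp: H_eq)
    then show "G j \<in> X - H i" using GX[OF \<open>j \<in> I\<close>] by blast
  qed
  have surj: "G ` I = X"
  proof (cases "finite X")
    case True
    then have I: "I = {..<card X}" by (auto simp: I_def)
    show ?thesis
      using True inj GX by (intro card_subset_eq) (auto simp: card_image I)
  next
    case False
    then have I: "I = UNIV" by (auto simp: I_def)
    have "x \<in> range G" if "x \<in> X" for x
    proof (rule ccontr)
      \<comment> \<open>An \<open>x\<close> never picked would stay a candidate forever, so the
        infinitely many distinct picks would all lie in one finite superlevel set.\<close>
      assume "x \<notin> range G"
      then have "x \<in> X - H n" for n using that by (auto simp: H_eq)
      then have "range G \<subseteq> {y \<in> X. f y \<ge> f x}"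
        using GX G_max[of _ x] by (auto simp: I)
      then have "finite (range G)" using fin[of "f x"] pos[OF that] finite_subset by blast
      then show False using inj by (simp add: I finite_image_iff)
    qed
    then show ?thesis using GX by (auto simp: I)
  qed
  show ?thesis using inj surj dec by (auto simp: bij_betw_def)
qed

section \<open>Gaps as open intervals, and their existence in sorted order\<close>

text \<open>The endpoints of the hull belong to \<open>C\<close>: otherwise \<open>C\<close> would
  lie in a half-open interval, which is convex and would contain the hull. So the hull may be
  replaced by its interior before \<open>C\<close> is removed.\<close>

lemma open_hull_minus_compact:
  fixes C :: "real set"
  assumes "compact C"
  shows "open (convex hull C - C)"
proof -
  have "connected (convex hull C)" "compact (convex hull C)"
    using assms by (simp_all add: compact_convex_hull convex_connected)
  then obtain a b where ab: "convex hull C = {a..b}"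
    using connected_compact_interval_1 by blast
  have "convex hull C - C = {a<..<b} - C"
  proof (cases "a \<le> b")
    case True
    have sub: "C \<subseteq> {a..b}" using hull_subset[of C convex] ab by simp
    have "a \<in> C"
    proof (rule ccontr)
      assume "a \<notin> C"
      then have "C \<subseteq> {a<..b}" using sub by (auto simp: less_le subset_iff)
      then have "{a..b} \<subseteq> {a<..b}" using hull_minimal[of C _ convex] ab by auto
      then show False using True by (auto simp: subset_iff)
    qed
    moreover have "b \<in> C"
    proof (rule ccontr)
      assume "b \<notin> C"
      then have "C \<subseteq> {a..<b}" using sub by (auto simp: less_le subset_iff)
      then have "{a..b} \<subseteq> {a..<b}" using hull_minimal[of C _ convex] ab by auto
      then show False using True by (auto simp: subset_iff)
    qed
    ultimately show ?thesis unfolding ab by (auto simp: less_le)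
  qed (use ab in auto)
  then show ?thesis using compact_imp_closed[OF assms] by (simp add: open_Diff)
qed

text \<open>A gap is open, bounded and connected. Openness keeps \<open>Inf g\<close> and
  \<open>Sup g\<close> out of it, connectedness fills everything between them.\<close>

lemma gap_interval:
  assumes "compact C" "g \<in> gaps C"
  obtains c d where "c < d" "g = {c<..<d}"
proof -
  have g: "open g" "is_interval g" "g \<noteq> {}" "g \<subseteq> convex hull C"
    using assms open_components[OF open_hull_minus_compact[OF assms(1)]]
      in_components_connected[of g] in_components_nonempty[of g]
      in_components_subset[of g "convex hull C - C"]
    by (auto simp: gaps_def is_interval_connected_1)
  have bdd: "bdd_above g" "bdd_below g"
    using bounded_subset[OF bounded_convex_hull[OF compact_imp_bounded[OF assms(1)]] g(4)]
    by (auto simp: bounded_imp_bdd_above bounded_imp_bdd_below)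
  have "g = {Inf g<..<Sup g}"
  proof (intro equalityI subsetI)
    fix x assume x: "x \<in> g"
    then obtain e where e: "e > 0" "cball x e \<subseteq> g" using g(1) open_contains_cball by blast
    then have "x - e \<in> g" "x + e \<in> g" by (auto simp: dist_real_def subset_iff)
    then show "x \<in> {Inf g<..<Sup g}"
      using cInf_lower[OF _ bdd(2)] cSup_upper[OF _ bdd(1)] e(1) by force
  next
    fix x assume x: "x \<in> {Inf g<..<Sup g}"
    then obtain u v where "u \<in> g" "u < x" "v \<in> g" "x < v"
      using cInf_less_iff[OF g(3) bdd(2)] less_cSup_iff[OF g(3) bdd(1)] by auto
    then show "x \<in> g" using g(2) unfolding is_interval_1 by (meson less_imp_le)
  qed
  moreover have "Inf g < Sup g" using calculation g(3)
    by (metis greaterThanLessThan_empty_iff not_le)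
  ultimately show ?thesis using that by blast
qed

text \<open>Disjoint gaps of length at least \<open>e\<close> fit into the hull at most
  \<open>?L / e\<close> times. The bound is uniform over finite subfamilies, so the whole family is
  finite.\<close>

lemma finite_long_gaps:
  assumes "compact C" "e > 0"
  shows "finite {g \<in> gaps C. len g \<ge> e}"
proof -
  let ?L = "len (convex hull C)"
  have hull: "convex hull C \<in> fmeasurable lborel"
    using assms(1) by (simp add: compact_convex_hull fmeasurable_compact)
  have "card F \<le> nat \<lfloor>?L / e\<rfloor>" if F: "F \<subseteq> {g \<in> gaps C. len g \<ge> e}" "finite F" for F
  proof -
    have meas: "g \<in> fmeasurable lborel" if "g \<in> F" for g
    proof -
      have "g \<in> gaps C" using that F by auto
      then show ?thesis by (rule gap_interval[OF assms(1)]) (simp add: fmeasurable_def)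
    qed
    have disj: "pairwise disjnt F"
      using F pairwise_disjoint_components[of "convex hull C - C"]
      by (auto simp: gaps_def pairwise_def disjnt_def)
    have "real (card F) * e \<le> (\<Sum>g\<in>F. len g)"
      using F sum_bounded_below[of F e len] by (auto simp: subset_iff)
    also have "\<dots> = len (\<Union>F)"
      using F meas disj by (subst measure_Union') auto
    also have "\<dots> \<le> ?L"
    proof (rule measure_mono_fmeasurable)
      show "\<Union>F \<subseteq> convex hull C"
        using F in_components_subset by (fastforce simp: gaps_def)
      show "\<Union>F \<in> sets lborel" using F meas by (auto simp: fmeasurable_def)
    qed (rule hull)
    finally have "real (card F) \<le> ?L / e" using assms(2) by (simp add: field_simps)
    then show ?thesis by linarith
  qed
  then show ?thesis using finite_if_finite_subsets_card_bdd by blast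
qed

text \<open>Ensures that the choice made in \<open>thickness\<close> yields a genuine
  enumeration.\<close>

lemma gap_enumeration_exists:
  assumes "compact C"
  shows "\<exists>G. gap_enumeration C G"
proof -
  have "len g > 0" if "g \<in> gaps C" for g
    using gap_interval[OF assms that] by force
  then show ?thesis
    unfolding gap_enumeration_def gap_indices_def
    by (intro greedy_enumeration finite_long_gaps[OF assms]) auto
qed

section \<open>Parent intervals and bridges\<close>

text \<open>The description in \<open>parent_interval\<close> is proper: \<open>G n\<close> is
  connected and disjoint from the earlier gaps, hence inside exactly one component. Removing open
  gaps from the hull leaves a compact set, so this component is a closed interval.\<close>

lemma parent_interval:
  assumes C: "compact C" and G: "gap_enumeration C G" and n: "n \<in> gap_indices C"
  shows "parent_interval C G n \<in> components (convex hull C - (\<Union>i<n. G i))"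
    and "G n \<subseteq> parent_interval C G n"
    and "\<exists>a b. parent_interval C G n = {a..b}"
proof -
  let ?S = "convex hull C - (\<Union>i<n. G i)"
  let ?J = "parent_interval C G n"
  have bij: "bij_betw G (gap_indices C) (gaps C)"
    using G by (simp add: gap_enumeration_def)
  have idx: "i \<in> gap_indices C" if "i < n" for i
    using n that by (auto simp: gap_indices_def)
  have gap: "G i \<in> gaps C" if "i \<le> n" for i
    using bij_betw_apply[OF bij] idx n that by (cases "i = n") auto
  have "G n \<inter> G i = {}" if "i < n" for i
  proof -
    have "G n \<noteq> G i" using bij n idx[OF that] that by (auto simp: bij_betw_def inj_on_def)
    then show ?thesis
      using gap[of n] gap[of i] that components_nonoverlap[of "G n" "convex hull C - C" "G i"]
      by (simp add: gaps_def)
  qed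
  then have sub: "G n \<subseteq> ?S"
    using gap[of n] in_components_subset by (fastforce simp: gaps_def)
  have conn: "connected (G n)" and ne: "G n \<noteq> {}"
    using gap[of n] in_components_connected in_components_nonempty by (auto simp: gaps_def)
  obtain J where J: "J \<in> components ?S" "G n \<subseteq> J"
    using exists_component_superset[OF sub _ conn] sub ne by blast
  have uniq: "J' = J" if "J' \<in> components ?S \<and> G n \<subseteq> J'" for J'
    using that J ne components_nonoverlap[of J' ?S J] by blast
  have eq: "?J = J"
    unfolding parent_interval_def
  proof (rule the_equality)
    show "J \<in> components ?S \<and> G n \<subseteq> J" using J by (rule conjI)
  qed (rule uniq)
  show "?J \<in> components ?S" "G n \<subseteq> ?J" using J eq by auto
  have "open (G i)" if "i < n" for i
    using gap_interval[OF C gap[of i]] that by (metis less_imp_le open_greaterThanLessThan)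
  then have "compact ?S"
    using C by (intro compact_diff) (auto simp: compact_convex_hull)
  then have "compact J" using J(1) compact_components by blast
  then show "\<exists>a b. ?J = {a..b}"
    using eq J(1) in_components_connected connected_compact_interval_1 by blast
qed

lemma bridge_intervals:
  assumes C: "compact C" and G: "gap_enumeration C G" and n: "n \<in> gap_indices C"
  obtains a b c d where "a \<le> c" "c < d" "d \<le> b" "parent_interval C G n = {a..b}"
    "G n = {c<..<d}" "left_bridge C G n = {a..c}" "right_bridge C G n = {d..b}"
proof -
  note P = parent_interval[OF C G n]
  obtain a b where J: "parent_interval C G n = {a..b}" using P(3) by blast
  have "G n \<in> gaps C" using G n by (auto simp: gap_enumeration_def bij_betw_def)
  then obtain c d where cd: "c < d" "G n = {c<..<d}" by (rule gap_interval[OF C])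
  have sub: "a \<le> c" "d \<le> b"
    using P(2) cd unfolding J
    by (auto simp: greaterThanLessThan_subseteq_atLeastAtMost_iff)
  \<comment> \<open>As the gap is open, lying strictly below all its points still allows its
    endpoint \<open>c\<close>; hence the bridges are closed intervals.\<close>
  have "(\<forall>g\<in>{c<..<d}. x < g) \<longleftrightarrow> x \<le> c" for x
    using dense_ge_bounded[OF cd(1), of x]
    by (meson greaterThanLessThan_iff less_imp_le le_less_trans)
  then have L: "left_bridge C G n = {a..c}" using cd sub by (auto simp: left_bridge_def J)
  have "(\<forall>g\<in>{c<..<d}. g < x) \<longleftrightarrow> d \<le> x" for x
    using dense_le_bounded[OF cd(1), of x]
    by (meson greaterThanLessThan_iff less_imp_le less_le_trans)
  then have R: "right_bridge C G n = {d..b}" using cd sub by (auto simp: right_bridge_def J)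
  show ?thesis using that[OF sub(1) cd(1) sub(2) J cd(2) L R] .
qed

text \<open>The earlier gap \<open>G m\<close> has been cut out, so \<open>p\<close> lies outside
  the parent interval of \<open>G n\<close>. The way from \<open>q\<close> to \<open>p\<close>
  therefore crosses a whole bridge and, strictly, a piece of \<open>G n\<close>.\<close>

lemma bridge_less_distance:
  assumes C: "compact C" and G: "gap_enumeration C G"
    and n: "n \<in> gap_indices C" and m: "m < n"
    and p: "p \<in> G m" and q: "q \<in> G n"
  shows "min (len (left_bridge C G n)) (len (right_bridge C G n)) < \<bar>p - q\<bar>"
proof -
  obtain a b c d where *: "a \<le> c" "c < d" "d \<le> b" "parent_interval C G n = {a..b}"
    "G n = {c<..<d}" "left_bridge C G n = {a..c}" "right_bridge C G n = {d..b}"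
    by (rule bridge_intervals[OF C G n])
  have "p \<notin> {a..b}"
    using in_components_subset[OF parent_interval(1)[OF C G n]] m p unfolding *(4) by blast
  then show ?thesis using q * by (auto simp: min_def)
qed

section \<open>Thickness and distances between gaps\<close>

lemma thickness_enumeration:
  assumes C: "compact C" and ne: "gaps C \<noteq> {}"
  obtains G where "gap_enumeration C G"
    "\<And>n. n \<in> gap_indices C \<Longrightarrow> thickness C \<le>
       ereal (min (len (left_bridge C G n)) (len (right_bridge C G n)) / len (G n))"
proof
  let ?G = "SOME G. gap_enumeration C G"
  show "gap_enumeration C ?G" using gap_enumeration_exists[OF C] by (rule someI_ex)
  show "thickness C \<le>
       ereal (min (len (left_bridge C ?G n)) (len (right_bridge C ?G n)) / len (?G n))"
    if "n \<in> gap_indices C" for n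
    using that ne unfolding thickness_def Let_def by (auto intro: INF_lower)
qed

text \<open>One gap already bounds the infimum by a real quotient.\<close>

lemma thickness_finite:
  assumes "compact C" "gaps C \<noteq> {}"
  shows "thickness C \<noteq> \<infinity>"
proof -
  have "gap_indices C \<noteq> {}"
    using assms(2) by (auto simp: gap_indices_def card_gt_0_iff intro!: exI[of _ 0])
  then show ?thesis using thickness_enumeration[OF assms]
    by (metis all_not_in_conv ereal_infty_less_eq(1) PInfty_neq_ereal(1))
qed

text \<open>The gap of larger index is the one of smaller or equal length, and both its bridges have
  at least \<open>t\<close> times that length.\<close>

lemma thick_gap_distance:
  assumes C: "compact C" and t: "thickness C = ereal t"
    and gh: "g \<in> gaps C" "h \<in> gaps C" "g \<noteq> h" and pq: "p \<in> g" "q \<in> h"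
  shows "t * min (len g) (len h) < \<bar>p - q\<bar>"
proof -
  obtain G where G: "gap_enumeration C G"
    "\<And>n. n \<in> gap_indices C \<Longrightarrow> thickness C \<le>
       ereal (min (len (left_bridge C G n)) (len (right_bridge C G n)) / len (G n))"
    using thickness_enumeration[OF C] gh(1) by blast
  have bij: "bij_betw G (gap_indices C) (gaps C)"
    using G(1) by (simp add: gap_enumeration_def)
  have main: "t * min (len (G m)) (len (G n)) < \<bar>x - y\<bar>"
    if mn: "m \<in> gap_indices C" "n \<in> gap_indices C" "m < n" and xy: "x \<in> G m" "y \<in> G n" for m n x y
  proof -
    have "G n \<in> gaps C" using bij mn bij_betwE by blast
    then have pos: "len (G n) > 0" using gap_interval[OF C] by force
    have "len (G n) \<le> len (G m)" using G(1) mn by (simp add: gap_enumeration_def)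
    then have "t * min (len (G m)) (len (G n)) = t * len (G n)" by simp
    also have "\<dots> \<le> min (len (left_bridge C G n)) (len (right_bridge C G n))"
      using G(2)[OF mn(2)] pos by (simp add: t pos_le_divide_eq)
    also have "\<dots> < \<bar>x - y\<bar>" using bridge_less_distance[OF C G(1) mn(2,3) xy] .
    finally show ?thesis .
  qed
  obtain m n where mn: "m \<in> gap_indices C" "n \<in> gap_indices C" "g = G m" "h = G n"
    using gh(1,2) bij_betw_imp_surj_on[OF bij] by (metis imageE)
  then consider "m < n" | "n < m" using gh(3) by (metis linorder_neqE_nat)
  then show ?thesis
    using main[of m n p q] main[of n m q p] mn pq
    by cases (auto simp: min.commute abs_minus_commute)
qed

text \<open>The left bridge is at least \<open>t * len g\<close> long and lies in the hull. This
  keeps Bob's first ball from being too small for any gap.\<close>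

lemma thickness_mult_gap_le:
  assumes C: "compact C" and t: "thickness C = ereal t" and g: "g \<in> gaps C"
  shows "t * len g \<le> len (convex hull C)"
proof -
  obtain G where G: "gap_enumeration C G"
    "\<And>n. n \<in> gap_indices C \<Longrightarrow> thickness C \<le>
       ereal (min (len (left_bridge C G n)) (len (right_bridge C G n)) / len (G n))"
    using thickness_enumeration[OF C] g by blast
  obtain n where n: "n \<in> gap_indices C" "g = G n"
    using G(1) g unfolding gap_enumeration_def by (metis bij_betw_imp_surj_on imageE)
  obtain a b c d where *: "a \<le> c" "c < d" "d \<le> b" "parent_interval C G n = {a..b}"
    "G n = {c<..<d}" "left_bridge C G n = {a..c}" "right_bridge C G n = {d..b}"
    by (rule bridge_intervals[OF C G(1) n(1)])
  have "t * len g \<le> len {a..c}"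
    using G(2)[OF n(1)] * n(2) by (simp add: t pos_le_divide_eq)
  also have "\<dots> \<le> len (convex hull C)"
  proof (rule measure_mono_fmeasurable)
    have "{a..c} \<subseteq> {a..b}" using * by auto
    then show "{a..c} \<subseteq> convex hull C"
      using in_components_subset[OF parent_interval(1)[OF C G(1) n(1)]] unfolding *(4) by blast
  qed (use C in \<open>auto simp: compact_convex_hull fmeasurable_compact\<close>)
  finally show ?thesis .
qed

section \<open>Alice's strategy\<close>

definition erasable :: "real set \<Rightarrow> real \<Rightarrow> real \<Rightarrow> real \<times> real \<Rightarrow> real set \<Rightarrow> bool" where
  "erasable C t \<beta> b g \<longleftrightarrow> g \<in> gaps C \<and> g \<inter> cball (fst b) (snd b) \<noteq> {} \<and>
     t * \<beta> * len g \<le> 2 * snd b \<and> 2 * snd b \<le> t * len g"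

text \<open>Lets Alice manage with a single ball per turn, as \<open>c = 0\<close> demands.\<close>

lemma erasable_unique:
  assumes "compact C" "thickness C = ereal t" "t > 0" "erasable C t \<beta> b g" "erasable C t \<beta> b h"
  shows "g = h"
proof (rule ccontr)
  assume "g \<noteq> h"
  obtain p q where pq: "p \<in> g" "q \<in> h" "p \<in> cball (fst b) (snd b)" "q \<in> cball (fst b) (snd b)"
    using assms by (auto simp: erasable_def)
  have "2 * snd b \<le> t * min (len g) (len h)"
    using assms by (simp add: erasable_def min_def)
  also have "\<dots> < \<bar>p - q\<bar>"
    using thick_gap_distance[OF assms(1,2) _ _ \<open>g \<noteq> h\<close> pq(1,2)] assms
    by (simp add: erasable_def)
  finally show False using pq by (auto simp: dist_real_def)
qed

text \<open>Only Bob's last ball matters. As an image over all erasable gaps, the answer is a pass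
  when there is none; the ball of each gap is the gap itself.\<close>

definition gap_strategy :: "real set \<Rightarrow> real \<Rightarrow> real \<Rightarrow> (real \<times> real) list \<Rightarrow> erased_ball set" where
  "gap_strategy C t \<beta> bs =
     (\<lambda>g. Open_Ball ((Inf g + Sup g) / 2) (len g / 2)) ` {g. erasable C t \<beta> (last bs) g}"

lemma gap_as_ball:
  assumes "compact C" "g \<in> gaps C"
  shows "ball ((Inf g + Sup g) / 2) (len g / 2) = g" "len g > 0"
proof -
  obtain c d where "c < d" "g = {c<..<d}" using gap_interval[OF assms] .
  then show "ball ((Inf g + Sup g) / 2) (len g / 2) = g" "len g > 0"
    by (simp_all add: ball_eq_greaterThanLessThan flip: add_divide_distrib diff_divide_distrib)
qed

text \<open>Take the first \<open>m\<close> with \<open>r m \<le> s\<close>. If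
  \<open>m > 0\<close>, the previous radius exceeds \<open>s\<close> and shrinks at most by the
  factor \<beta>; if \<open>m = 0\<close>, the bound on \<open>r 0\<close> applies.\<close>

lemma exists_scale:
  fixes r :: "nat \<Rightarrow> real"
  assumes "r \<longlonglongrightarrow> 0" "\<And>m. r (Suc m) \<ge> \<beta> * r m" "s > 0" "\<beta> > 0" "\<beta> * s \<le> r 0"
  shows "\<exists>m. \<beta> * s \<le> r m \<and> r m \<le> s"
proof -
  have "eventually (\<lambda>m. r m < s) sequentially" using assms by (intro order_tendstoD)
  then have ex: "\<exists>m. r m \<le> s" by (metis eventually_happens less_imp_le sequentially_bot)
  define m where "m = (LEAST m. r m \<le> s)"
  have "r m \<le> s" unfolding m_def using ex by (rule LeastI_ex)
  moreover have "\<beta> * s \<le> r m"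
  proof (cases m)
    case (Suc k)
    then have "s < r k" using not_less_Least[of k "\<lambda>m. r m \<le> s"] by (simp add: m_def)
    then have "\<beta> * s \<le> \<beta> * r k" using assms(4) by simp
    then show ?thesis using assms(2)[of k] Suc by simp
  qed (use assms in simp)
  ultimately show ?thesis by blast
qed

section \<open>The strategy wins\<close>

theorem proposition28:
  fixes C :: "real set" and \<beta> :: real
  assumes "compact C"
    and "convex hull C = {0..1}"
    and "thickness C > 0"
    and "0 < \<beta>" and "\<beta> < 1"
  shows "potential_winning (real_of_ereal (1 / (thickness C * ereal \<beta>))) \<beta> 0 (\<beta> / 2)
           ({..<0} \<union> C \<union> {1<..})"
proof (cases "gaps C = {}")
  case True
  \<comment> \<open>Without gaps the target set is the whole line, so Alice wins by passing.\<close>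
  then have "C = {0..1}"
    using hull_subset[of C convex] assms(2) by (auto simp: gaps_def)
  then have "{..<0} \<union> C \<union> {1<..} = UNIV" by auto
  then show ?thesis
    unfolding potential_winning_def by (intro exI[of _ "\<lambda>_. {}"]) (auto simp: alice_legal_def)
next
  case False
  then obtain t where t: "thickness C = ereal t" "t > 0"
    using thickness_finite[OF assms(1)] assms(3) by (cases "thickness C") auto
  let ?\<alpha> = "real_of_ereal (1 / (thickness C * ereal \<beta>))"
  have \<alpha>: "?\<alpha> = 1 / (t * \<beta>)" using t assms(4) by (simp add: one_ereal_def)
  have last: "last (bob_history x r m) = (x m, r m)" for x r m
    by (simp add: bob_history_def)
  have "alice_legal ?\<alpha> 0 (r m) (gap_strategy C t \<beta> (bob_history x r m))" for x r m
  proof (cases "\<exists>g. erasable C t \<beta> (x m, r m) g")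
    case True
    then obtain g where g: "erasable C t \<beta> (x m, r m) g" by blast
    then have "{h. erasable C t \<beta> (x m, r m) h} = {g}"
      using erasable_unique[OF assms(1) t] by blast
    moreover have "len g > 0" using gap_as_ball[OF assms(1)] g by (simp add: erasable_def)
    moreover have "len g / 2 \<le> ?\<alpha> * r m"
      using g t(2) assms(4) unfolding \<alpha> by (simp add: erasable_def field_simps)
    ultimately show ?thesis by (simp add: gap_strategy_def alice_legal_def last)
  qed (simp add: gap_strategy_def alice_legal_def last)
  moreover have "p \<in> {..<0} \<union> C \<union> {1<..}"
    if bob: "bob_play \<beta> (\<beta> / 2) x r" and p: "p \<in> (\<Inter>m. cball (x m) (r m))"
      and esc: "p \<notin> (\<Union>m. \<Union>b\<in>gap_strategy C t \<beta> (bob_history x r m). erased_set b)" for x r p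
  proof (rule ccontr)
    assume "p \<notin> {..<0} \<union> C \<union> {1<..}"
    then have "p \<in> convex hull C - C" using assms(2) by auto
    then obtain g where g: "g \<in> gaps C" "p \<in> g"
      unfolding gaps_def using Union_components by blast
    have "t * len g \<le> 1" using thickness_mult_gap_le[OF assms(1) t(1) g(1)] assms(2) by simp
    \<comment> \<open>The least initial radius \<beta>/2 is not below the window of any gap, so Bob
      must pass through the window with upper end \<open>t * len g / 2\<close>.\<close>
    then have "\<beta> * (t * len g / 2) \<le> \<beta> / 2" using assms(4) by (simp add: field_simps)
    also have "\<dots> \<le> r 0" using bob by (simp add: bob_play_def)
    finally obtain m where "\<beta> * (t * len g / 2) \<le> r m" "r m \<le> t * len g / 2"
      using exists_scale[of r \<beta> "t * len g / 2"] bob t(2) gap_as_ball(2)[OF assms(1) g(1)] assms(4)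
      by (auto simp: bob_play_def)
    \<comment> \<open>The outcome \<open>p\<close> lies in \<open>g\<close> and in all of Bob's
      balls, so \<open>g\<close> meets the ball of turn \<open>m\<close>.\<close>
    then have "erasable C t \<beta> (x m, r m) g" using g p
      by (auto simp: erasable_def mult.commute mult.left_commute)
    then show False
      using esc g gap_as_ball(1)[OF assms(1) g(1)]
      by (auto simp: gap_strategy_def last simp del: mem_ball)
  qed
  ultimately show ?thesis
    unfolding potential_winning_def by (intro exI[of _ "gap_strategy C t \<beta>"]) simp
qed

end
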